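(* Let $G_I$ be a connected interval graph with at least two vertices and interval model $I=\{I_1,\dots,I_n\}$, $I_i=[a_i,b_i]$, where no two intervals share an endpoint, and let $I'$ and the digraph $D$ be as described in the context. Let $D_S$ be a semitotal dominating set of $G_I$ such that no interval of the associated set $S=\{I_i: i\in D_S\}$ is properly contained within any interval in $I$, and write $D_S=\{i_1,\dots,i_k\}$ with $i_1<\dots<i_k$. Then $D_S$ corresponds to a directed path from vertex $0$ to vertex $n+1$ in $D$ which does not include any two consecutive unmarked arcs of $D$, namely the path $0,i_1,i_2,\dots,i_k,n+1$.
   Context: Vertex $i$ of $G_I$ corresponds to $I_i$; two vertices are adjacent iff their intervals intersect (overlap). A set $D_S$ of vertices is a semitotal dominating set if it is dominating and each vertex of $D_S$ is at distance at most $2$ from another vertex of $D_S$. Let $I'=I\cup\{I_0,I_{n+1}\}$ with $I_0=[a_0,b_0]$, $I_{n+1}=[a_{n+1},b_{n+1}]$, $b_0<\min_{k\in[n]}a_k$ and $a_{n+1}>\max_{k\in[n]}b_k$, and suppose the intervals are indexed so that $a_0<a_1<\dots<a_n<a_{n+1}$. The digraph $D=(V,A)$ has vertex set $V=\{k: I_k\in I' \text{ and } I_k \text{ is not contained in any other interval of } I'\}$ and arc set $A=A_1\cup A_2$ (disjoint), where: for intervals $I_i,I_j$ (indices in $V$) with $1\le i<j\le n$ that overlap, $(i,j)\in A_1$; for non-overlapping $I_i,I_j$ with $0\le i<j\le n+1$ (so $b_i<a_j$) such that there is no interval $I_h\in I'$ with $b_i<a_h$ and $b_h<a_j$, $(i,j)\in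 A_2$. An arc $(i,j)\in A_2$ is marked if some interval $I_h\in I'$ overlaps both $I_i$ and $I_j$, and unmarked otherwise. Paths are directed. *)

theory Defs
  imports "Graph_Theory.Graph_Theory"
begin

text \<open>
  An interval family is given by its endpoint functions \<open>a\<close> and \<open>b\<close>: the interval with
  index \<open>i\<close> is \<open>[a i, b i]\<close>. The indices \<open>1, \<dots>, n\<close> are those of \<open>I\<close>, and the indices
  \<open>0, \<dots>, n + 1\<close> are those of the extended family \<open>I'\<close>.
\<close>

definition overlap :: "(nat \<Rightarrow> real) \<Rightarrow> (nat \<Rightarrow> real) \<Rightarrow> nat \<Rightarrow> nat \<Rightarrow> bool" where
  "overlap a b i j \<longleftrightarrow> {a i..b i} \<inter> {a j..b j} \<noteq> {}"

text \<open>Undirected graphs are represented as symmetric loop-free digraphs.\<close>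

definition interval_graph :: "(nat \<Rightarrow> real) \<Rightarrow> (nat \<Rightarrow> real) \<Rightarrow> nat \<Rightarrow> nat pair_pre_digraph" where
  "interval_graph a b n =
     \<lparr>pverts = {1..n},
      parcs = {(i, j). i \<in> {1..n} \<and> j \<in> {1..n} \<and> i \<noteq> j \<and> overlap a b i j}\<rparr>"

definition dominating_set :: "('v, 'e) pre_digraph \<Rightarrow> 'v set \<Rightarrow> bool" where
  "dominating_set G S \<longleftrightarrow>
     S \<subseteq> verts G \<and> (\<forall>v \<in> verts G - S. \<exists>u \<in> S. u \<rightarrow>\<^bsub>G\<^esub> v)"

text \<open>Distance is the minimum cost of a walk for unit arc weights (infinite if there is none).\<close>

definition graph_dist :: "('v, 'e) pre_digraph \<Rightarrow> 'v \<Rightarrow> 'v \<Rightarrow> ereal" where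
  "graph_dist G u v = wf_digraph.\<mu> G (\<lambda>_. 1) u v"

definition semitotal_dominating_set :: "('v, 'e) pre_digraph \<Rightarrow> 'v set \<Rightarrow> bool" where
  "semitotal_dominating_set G S \<longleftrightarrow>
     dominating_set G S \<and> (\<forall>v \<in> S. \<exists>u \<in> S. u \<noteq> v \<and> graph_dist G v u \<le> 2)"

definition V_set :: "(nat \<Rightarrow> real) \<Rightarrow> (nat \<Rightarrow> real) \<Rightarrow> nat \<Rightarrow> nat set" where
  "V_set a b n =
     {k \<in> {0..n + 1}. \<not> (\<exists>h \<in> {0..n + 1}. h \<noteq> k \<and> {a k..b k} \<subseteq> {a h..b h})}"

definition A1_set :: "(nat \<Rightarrow> real) \<Rightarrow> (nat \<Rightarrow> real) \<Rightarrow> nat \<Rightarrow> (nat \<times> nat) set" where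
  "A1_set a b n =
     {(i, j). i \<in> V_set a b n \<and> j \<in> V_set a b n \<and> 1 \<le> i \<and> i < j \<and> j \<le> n \<and> overlap a b i j}"

definition A2_set :: "(nat \<Rightarrow> real) \<Rightarrow> (nat \<Rightarrow> real) \<Rightarrow> nat \<Rightarrow> (nat \<times> nat) set" where
  "A2_set a b n =
     {(i, j). i \<in> V_set a b n \<and> j \<in> V_set a b n \<and> i < j \<and> j \<le> n + 1 \<and> \<not> overlap a b i j \<and>
        \<not> (\<exists>h \<in> {0..n + 1}. b i < a h \<and> b h < a j)}"

definition D_graph :: "(nat \<Rightarrow> real) \<Rightarrow> (nat \<Rightarrow> real) \<Rightarrow> nat \<Rightarrow> nat pair_pre_digraph" where
  "D_graph a b n = \<lparr>pverts = V_set a b n, parcs = A1_set a b n \<union> A2_set a b n\<rparr>"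

definition marked :: "(nat \<Rightarrow> real) \<Rightarrow> (nat \<Rightarrow> real) \<Rightarrow> nat \<Rightarrow> nat \<times> nat \<Rightarrow> bool" where
  "marked a b n e \<longleftrightarrow>
     e \<in> A2_set a b n \<and> (\<exists>h \<in> {0..n + 1}. overlap a b h (fst e) \<and> overlap a b h (snd e))"

text \<open>Arcs of \<open>A1_set\<close> are neither marked nor unmarked.\<close>

definition unmarked :: "(nat \<Rightarrow> real) \<Rightarrow> (nat \<Rightarrow> real) \<Rightarrow> nat \<Rightarrow> nat \<times> nat \<Rightarrow> bool" where
  "unmarked a b n e \<longleftrightarrow> e \<in> A2_set a b n \<and> \<not> marked a b n e"

definition dipath :: "('v, 'e) pre_digraph \<Rightarrow> 'v \<Rightarrow> 'v list \<Rightarrow> 'v \<Rightarrow> bool" where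
  "dipath G u p v \<longleftrightarrow> vpath p G \<and> hd p = u \<and> last p = v"

definition no_consecutive :: "('e \<Rightarrow> bool) \<Rightarrow> 'e list \<Rightarrow> bool" where
  "no_consecutive P es \<longleftrightarrow> (\<forall>m. Suc m < length es \<longrightarrow> \<not> (P (es ! m) \<and> P (es ! Suc m)))"

lemma graph_interval_graph: "graph (with_proj (interval_graph a b n))"
proof -
  let ?G = "interval_graph a b n"
  have arcs: "parcs ?G \<subseteq> {1..n} \<times> {1..n}" and verts: "pverts ?G = {1..n}"
    and loop: "\<And>e. e \<in> parcs ?G \<Longrightarrow> fst e \<noteq> snd e"
    unfolding interval_graph_def by auto
  have "sym (parcs ?G)"
    unfolding sym_def interval_graph_def overlap_def by (simp add: Int_commute)
  then have sym: "symmetric (with_proj ?G)"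
    by (simp add: symmetric_def)
  interpret pair_graph ?G
  proof
    show "finite (parcs ?G)"
      using arcs by (rule finite_subset) simp
    show "finite (pverts ?G)"
      using verts by simp
    show "symmetric (with_proj ?G)"
      by (rule sym)
    fix e assume e: "e \<in> parcs ?G"
    show "fst e \<in> pverts ?G" "snd e \<in> pverts ?G"
      using subsetD[OF arcs e] verts by (simp_all add: mem_Times_iff)
    show "fst e \<noteq> snd e"
      using e by (rule loop)
  qed
  show ?thesis
    by unfold_locales
qed

lemma digraph_D_graph: "digraph (with_proj (D_graph a b n))"
proof -
  let ?G = "D_graph a b n"
  have arcs: "parcs ?G \<subseteq> V_set a b n \<times> V_set a b n" and verts: "pverts ?G = V_set a b n"
    and loop: "\<And>e. e \<in> parcs ?G \<Longrightarrow> fst e \<noteq> snd e"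
    unfolding D_graph_def A1_set_def A2_set_def by auto
  have fin: "finite (V_set a b n)"
    unfolding V_set_def by simp
  interpret pair_digraph ?G
  proof
    show "finite (parcs ?G)"
      using arcs by (rule finite_subset) (simp add: fin)
    show "finite (pverts ?G)"
      using verts fin by simp
    fix e assume e: "e \<in> parcs ?G"
    show "fst e \<in> pverts ?G" "snd e \<in> pverts ?G"
      using subsetD[OF arcs e] verts by (simp_all add: mem_Times_iff)
    show "fst e \<noteq> snd e"
      using e by (rule loop)
  qed
  show ?thesis
    by unfold_locales
qed

end

theory Submission
  imports Defs
begin

text \<open>
  Intervals that are not contained in one another are ordered alike by left and by right endpoints.
  If an interval \<open>h\<close> lay strictly between consecutive elements \<open>i < j\<close> of the set, any neighbour
  of \<open>h\<close> in \<open>D_S\<close> would start before \<open>a j\<close>, hence be at most \<open>i\<close>, and so end before \<open>a h\<close>: a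
  contradiction. This gives the arcs. For consecutive \<open>i < j < k\<close>, the element \<open>u\<close> of \<open>D_S\<close>
  within distance two of \<open>j\<close> satisfies \<open>u \<le> i\<close> or \<open>k \<le> u\<close>, and the interval meeting both
  \<open>u\<close> and \<open>j\<close> then also meets \<open>i\<close> or \<open>k\<close> respectively, so one of the two arcs is marked or in
  \<open>A1_set\<close>.
\<close>

section \<open>Walks and positions in lists\<close>

lemma awalk_of_graph_dist_le:
  assumes "wf_digraph G" and "graph_dist G u v \<le> ereal (real k)"
  obtains p where "pre_digraph.awalk G u p v" and "length p \<le> k"
proof -
  interpret wf_digraph G by fact
  \<comment> \<open>An infimum need not be attained, but a strict bound by \<open>Suc k\<close>
    yields a walk below it; unit costs are integers, so its length is at most
    \<open>k\<close>.\<close>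
  have "(INF p\<in>{p. awalk u p v}. ereal (awalk_cost (\<lambda>_. 1) p)) < ereal (real (Suc k))"
    using assms(2) unfolding graph_dist_def \<mu>_def
    by (rule le_less_trans) simp
  then obtain p where "awalk u p v" "awalk_cost (\<lambda>_. 1) p < real (Suc k)"
    unfolding INF_less_iff by auto
  moreover have "awalk_cost (\<lambda>_. 1) p = real (length p)"
    by (induction p) auto
  ultimately show thesis
    by (intro that) auto
qed

lemma length_vwalk_arcs: "length (vwalk_arcs p) = length p - 1"
  by (induction p rule: vwalk_arcs.induct) auto

lemma nth_vwalk_arcs: "Suc m < length p \<Longrightarrow> vwalk_arcs p ! m = (p ! m, p ! Suc m)"
proof (induction p arbitrary: m rule: vwalk_arcs.induct)
  case (3 x y xs)
  then show ?case by (cases m) auto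
qed auto

lemma sorted_wrt_less_nth_gap:
  fixes p :: "'a::linorder list"
  assumes "sorted_wrt (<) p" and "Suc m < length p" and "u \<in> set p"
  shows "u \<le> p ! m \<or> p ! Suc m \<le> u"
proof -
  obtain l where l: "l < length p" "u = p ! l"
    using assms(3) by (auto simp: in_set_conv_nth)
  have "sorted p"
    using assms(1) by (simp add: strict_sorted_iff)
  then show ?thesis
    using assms(2) l by (cases "l \<le> m") (auto intro: sorted_nth_mono)
qed

section \<open>Overlap, distance and domination in the interval graph\<close>

lemma overlap_iff:
  assumes "a i \<le> b i" and "a j \<le> b j"
  shows "overlap a b i j \<longleftrightarrow> a i \<le> b j \<and> a j \<le> b i"
  using assms unfolding overlap_def by auto

lemma common_neighbour_of_graph_dist_le_2:
  assumes "graph_dist (with_proj (interval_graph a b n)) u v \<le> 2" and "u \<noteq> v"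
  obtains h where "h \<in> {1..n}" and "overlap a b h u" and "overlap a b h v"
proof -
  let ?G = "with_proj (interval_graph a b n)"
  interpret graph ?G by (rule graph_interval_graph)
  have "graph_dist ?G u v \<le> ereal (real 2)"
    using assms(1) by simp
  then obtain p where p: "awalk u p v" "length p \<le> 2"
    by (rule awalk_of_graph_dist_le[OF wf_digraph_axioms])
  have walk: "set p \<subseteq> parcs (interval_graph a b n)" "cas u p v"
    using p(1) by (simp_all add: awalk_def)
  have "p \<noteq> []"
    using walk(2) assms(2) by auto
  with p(2) consider e where "p = [e]" | e f where "p = [e, f]"
    by (cases p rule: remdups_adj.cases) auto
  then show thesis
  proof cases
    case 1
    then have "(u, v) \<in> parcs (interval_graph a b n)"
      using walk by (cases e) auto
    then show ?thesis
      \<comment> \<open>For adjacent \<open>u\<close> and \<open>v\<close> the witness is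
        \<open>u\<close> itself: its interval meets that of \<open>v\<close>, hence is nonempty and
        overlaps itself.\<close>
      using that[of u] unfolding interval_graph_def overlap_def by auto
  next
    case 2
    then have "(u, snd e) \<in> parcs (interval_graph a b n)"
        "(snd e, v) \<in> parcs (interval_graph a b n)"
      using walk by (cases e; cases f; auto)+
    then show ?thesis
      using that[of "snd e"] unfolding interval_graph_def overlap_def
      by (auto simp: Int_commute)
  qed
qed

text \<open>Members of \<open>S\<close> are covered too, since a nonempty interval overlaps
  itself.\<close>

lemma dominating_set_interval_graphE:
  assumes "dominating_set (with_proj (interval_graph a b n)) S"
    and "h \<in> {1..n}" and "a h \<le> b h"
  obtains u where "u \<in> S" and "overlap a b u h"
proof (cases "h \<in> S")
  case True
  then show thesis
    using that[of h] assms(3) by (simp add: overlap_def)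
next
  case False
  then show thesis
    using assms(1,2) that unfolding dominating_set_def by (fastforce simp: interval_graph_def)
qed

text \<open>Pointwise form of the conditions on the extended family; \<open>first\<close> and
  \<open>last\<close> also separate the two added intervals from each other.\<close>

locale extended_interval_model =
  fixes a b :: "nat \<Rightarrow> real" and n :: nat
  assumes le: "i \<le> n + 1 \<Longrightarrow> a i \<le> b i"
    and less_Suc: "i \<le> n \<Longrightarrow> a i < a (Suc i)"
    and first: "1 \<le> i \<Longrightarrow> i \<le> n + 1 \<Longrightarrow> b 0 < a i"
    and last: "i \<le> n \<Longrightarrow> b i < a (n + 1)"
begin

lemma a_less: "i < j \<Longrightarrow> j \<le> n + 1 \<Longrightarrow> a i < a j"
proof (induction j)
  case (Suc j)
  then show ?case
    using less_Suc[of j] by (cases "i = j") auto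
qed simp

lemma a_less_iff: "i \<le> n + 1 \<Longrightarrow> j \<le> n + 1 \<Longrightarrow> a i < a j \<longleftrightarrow> i < j"
  using a_less[of i j] a_less[of j i] by (cases i j rule: linorder_cases) auto

lemma overlap_iff': "i \<le> n + 1 \<Longrightarrow> j \<le> n + 1 \<Longrightarrow> overlap a b i j \<longleftrightarrow> a i \<le> b j \<and> a j \<le> b i"
  by (simp add: overlap_iff le)

lemma V_setD: "k \<in> V_set a b n \<Longrightarrow> k \<le> n + 1"
  by (auto simp: V_set_def)

text \<open>If \<open>b j < b i\<close> while \<open>a i < a j\<close>, the interval of
  \<open>j\<close> would lie inside that of \<open>i\<close>.\<close>

lemma b_mono_V_set:
  assumes "i \<in> V_set a b n" and "j \<in> V_set a b n" and "i \<le> j"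
  shows "b i \<le> b j"
proof (cases "i = j")
  case False
  then have "a i < a j"
    using assms V_setD a_less by simp
  moreover have "\<not> {a j..b j} \<subseteq> {a i..b i}"
    using assms False unfolding V_set_def by auto
  ultimately show ?thesis by auto
qed simp

lemma zero_mem_V_set: "0 \<in> V_set a b n"
proof -
  have "\<not> {a 0..b 0} \<subseteq> {a h..b h}" if "h \<noteq> 0" "h \<le> n + 1" for h
    using first[of h] le[of 0] that by auto
  then show ?thesis by (auto simp: V_set_def)
qed

lemma Suc_n_mem_V_set: "n + 1 \<in> V_set a b n"
proof -
  have "\<not> {a (n + 1)..b (n + 1)} \<subseteq> {a h..b h}" if "h \<noteq> n + 1" "h \<le> n + 1" for h
    using last[of h] le[of "n + 1"] that by auto
  then show ?thesis by (auto simp: V_set_def)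
qed

lemma mem_V_setI:
  assumes "i \<in> {1..n}" and "\<And>h. h \<in> {1..n} \<Longrightarrow> \<not> {a i..b i} \<subset> {a h..b h}"
  shows "i \<in> V_set a b n"
proof -
  have "\<not> {a i..b i} \<subseteq> {a h..b h}" if h: "h \<noteq> i" "h \<le> n + 1" for h
  proof
    assume sub: "{a i..b i} \<subseteq> {a h..b h}"
    have i: "a i \<le> b i" "b 0 < a i" "b i < a (n + 1)"
      using assms(1) le first last by auto
    \<comment> \<open>The added intervals lie wholly to the left and to the right of the interval of
      \<open>i\<close>, so neither contains it.\<close>
    have "h \<noteq> 0" "h \<noteq> n + 1"
      using sub i by (auto intro!: gr0I)
    then have "h \<in> {1..n}"
      using h by auto
    \<comment> \<open>Distinct left endpoints make any containment proper, so the assumption on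
      proper containment applies.\<close>
    moreover have "a i \<noteq> a h"
      using h assms(1) a_less[of i h] a_less[of h i] by (cases i h rule: linorder_cases) auto
    then have "{a i..b i} \<noteq> {a h..b h}"
      using i by (auto simp: Icc_eq_Icc)
    ultimately show False
      using assms(2) sub by blast
  qed
  then show ?thesis
    using assms(1) by (auto simp: V_set_def)
qed

section \<open>Arcs between consecutive elements of a dominating set\<close>

context
  fixes S :: "nat set"
  assumes S_verts: "S \<subseteq> {1..n}"
    and S_V_set: "S \<subseteq> V_set a b n"
    and S_dom: "dominating_set (with_proj (interval_graph a b n)) S"
begin

lemma gap_arc:
  assumes i: "i \<in> insert 0 S" and j: "j \<in> insert (n + 1) S" and ij: "i < j"
    and gap: "\<And>u. u \<in> S \<Longrightarrow> u \<le> i \<or> j \<le> u"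
  shows "(i, j) \<in> A1_set a b n \<union> A2_set a b n"
proof -
  have V: "i \<in> V_set a b n" "j \<in> V_set a b n"
    using i j S_V_set zero_mem_V_set Suc_n_mem_V_set by auto
  have bounds: "i \<le> n" "1 \<le> j" "j \<le> n + 1"
    using i j S_verts ij by auto
  show ?thesis
  proof (cases "overlap a b i j")
    case True
    then have "a j \<le> b i"
      using bounds by (simp add: overlap_iff')
    \<comment> \<open>Added intervals meet no other interval, so both indices are in the range that
      \<open>A1_set\<close> demands.\<close>
    then have "i \<noteq> 0" "j \<noteq> n + 1"
      using first[of j] last[of i] bounds by (auto intro!: gr0I)
    then show ?thesis
      using True V ij bounds by (simp add: A1_set_def)
  next
    case False
    have "False" if h: "h \<le> n + 1" "b i < a h" "b h < a j" for h
    proof -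
      have "a 0 \<le> a i" "a j \<le> a (n + 1)"
        using a_less[of 0 i] a_less[of j "n + 1"] bounds by (cases "i = 0"; cases "j = n + 1"; simp)+
      \<comment> \<open>Thus \<open>h\<close> is a vertex of the interval graph, and domination
        applies to it.\<close>
      then have "h \<noteq> 0" "h \<noteq> n + 1"
        using h le[of i] le[of "n + 1"] bounds by (auto intro!: gr0I)
      then obtain u where u: "u \<in> S" "overlap a b u h"
        using dominating_set_interval_graphE[OF S_dom, of h] le[of h] h(1) by auto
      then have u': "u \<le> n + 1" "a u \<le> b h" "a h \<le> b u"
        using S_verts h(1) overlap_iff' by auto
      have "a u < a j"
        using u' h by simp
      then have "u < j"
        using a_less_iff[of u j] u'(1) bounds by simp
      then have "b u \<le> b i"
        using gap[OF u(1)] b_mono_V_set[of u i] u(1) S_V_set V by auto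
      then show False
        using u' h by simp
    qed
    then show ?thesis
      using False V ij bounds unfolding A2_set_def by auto
  qed
qed

text \<open>The ends \<open>i\<close> and \<open>k\<close> may be the added indices; only the middle
  vertex \<open>j\<close> must lie in \<open>S\<close> for the distance condition to apply.\<close>

lemma no_two_unmarked:
  assumes dist: "\<And>v. v \<in> S \<Longrightarrow>
      \<exists>u \<in> S. u \<noteq> v \<and> graph_dist (with_proj (interval_graph a b n)) v u \<le> 2"
    and j: "j \<in> S"
    and gap: "\<And>u. u \<in> S \<Longrightarrow> u \<le> i \<or> j \<le> u" "\<And>u. u \<in> S \<Longrightarrow> u \<le> j \<or> k \<le> u"
  shows "\<not> (unmarked a b n (i, j) \<and> unmarked a b n (j, k))"
proof
  assume unm: "unmarked a b n (i, j) \<and> unmarked a b n (j, k)"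
  then have A2: "(i, j) \<in> A2_set a b n" "(j, k) \<in> A2_set a b n"
    and no_common: "\<And>h. h \<le> n + 1 \<Longrightarrow> \<not> (overlap a b h i \<and> overlap a b h j)"
      "\<And>h. h \<le> n + 1 \<Longrightarrow> \<not> (overlap a b h j \<and> overlap a b h k)"
    by (auto simp: unmarked_def marked_def)
  then have V: "i \<in> V_set a b n" "j \<in> V_set a b n" "k \<in> V_set a b n" and "i < j" "j < k"
    and no: "\<not> overlap a b i j" "\<not> overlap a b j k"
    by (auto simp: A2_set_def)
  note bounds = V[THEN V_setD]
  have sep: "b i < a j" "b j < a k"
    using no a_less[of i j] a_less[of j k] \<open>i < j\<close> \<open>j < k\<close> bounds le[of j] le[of k]
    by (auto simp: overlap_iff')
  obtain u where u: "u \<in> S" "u \<noteq> j"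
      "graph_dist (with_proj (interval_graph a b n)) j u \<le> 2"
    using dist[OF j] by blast
  obtain h where h: "h \<in> {1..n}" "overlap a b h j" "overlap a b h u"
    using common_neighbour_of_graph_dist_le_2[OF u(3)] u(2) by metis
  have u_bound: "u \<le> n + 1" "u \<in> V_set a b n"
    using u(1) S_verts S_V_set by auto
  have h': "h \<le> n + 1" "a h \<le> b j" "a j \<le> b h" "a h \<le> b u" "a u \<le> b h"
    using h u_bound bounds by (auto simp: overlap_iff')
  consider "u \<le> i" | "k \<le> u"
    using gap[OF u(1)] u(2) by fastforce
  then show False
  proof cases
    case 1
    then have "b u \<le> b i"
      using b_mono_V_set V u_bound by blast
    \<comment> \<open>Here \<open>a h \<le> b u \<le> b i\<close> and
      \<open>a i \<le> b i < a j \<le> b h\<close>.\<close>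
    then have "overlap a b h i"
      using h' sep bounds le[of i] by (simp add: overlap_iff')
    then show False
      using no_common(1) h(2) h'(1) by blast
  next
    case 2
    then have "a k \<le> a u"
      using a_less[of k u] u_bound by (cases "k = u") auto
    \<comment> \<open>Symmetrically, \<open>a k \<le> a u \<le> b h\<close> and
      \<open>a h \<le> b j < a k \<le> b k\<close>.\<close>
    then have "overlap a b h k"
      using h' sep bounds le[of k] by (simp add: overlap_iff')
    then show False
      using no_common(2) h(2) h'(1) by blast
  qed
qed

end

end

section \<open>Assembling the path\<close>

theorem theorem6:
  fixes a b :: "nat \<Rightarrow> real" and n :: nat and D_S :: "nat set"
  assumes "n \<ge> 2"
    and "\<forall>i \<in> {0..n + 1}. a i \<le> b i"
    and "\<forall>i \<in> {1..n}. \<forall>j \<in> {1..n}. i \<noteq> j \<longrightarrow> {a i, b i} \<inter> {a j, b j} = {}"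
    and "b 0 < Min (a ` {1..n})"
    and "a (n + 1) > Max (b ` {1..n})"
    and "\<forall>i \<in> {0..n}. a i < a (i + 1)"
    and "Digraph_Component.connected (with_proj (interval_graph a b n))"
    and "semitotal_dominating_set (with_proj (interval_graph a b n)) D_S"
    and "\<forall>i \<in> D_S. \<forall>h \<in> {1..n}. \<not> {a i..b i} \<subset> {a h..b h}"
  defines "p \<equiv> 0 # sorted_list_of_set D_S @ [n + 1]"
  shows "dipath (with_proj (D_graph a b n)) 0 p (n + 1) \<and>
         no_consecutive (unmarked a b n) (vwalk_arcs p)"
proof -
  have first: "b 0 < a i" if "i \<in> {1..n}" for i
    using assms(4) Min_le[of "a ` {1..n}" "a i"] that by simp
  have last: "b i < a (n + 1)" if "i \<in> {1..n}" for i
    using assms(5) Max_ge[of "b ` {1..n}" "b i"] that by simp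
  \<comment> \<open>The added intervals are compared through the interval of index 1, which exists
    since \<open>n \<ge> 2\<close>.\<close>
  have first_last: "b 0 < a (n + 1)"
    using first[of 1] last[of 1] assms(1) assms(2)[rule_format, of 1] by simp
  interpret extended_interval_model a b n
  proof
    fix i
    show "a i \<le> b i" if "i \<le> n + 1" using assms(2) that by simp
    show "a i < a (Suc i)" if "i \<le> n" using assms(6) that by simp
    show "b 0 < a i" if "1 \<le> i" "i \<le> n + 1"
      using first[of i] first_last that by (cases "i = n + 1") auto
    show "b i < a (n + 1)" if "i \<le> n"
      using last[of i] first_last that by (cases "i = 0") auto
  qed
  have dom: "dominating_set (with_proj (interval_graph a b n)) D_S"
    and dist: "\<And>v. v \<in> D_S \<Longrightarrow>
      \<exists>u \<in> D_S. u \<noteq> v \<and> graph_dist (with_proj (interval_graph a b n)) v u \<le> 2"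
    using assms(8) by (auto simp: semitotal_dominating_set_def)
  have sub: "D_S \<subseteq> {1..n}"
    using dom by (simp add: dominating_set_def interval_graph_def)
  have sub_V: "D_S \<subseteq> V_set a b n"
    using mem_V_setI sub assms(9) by blast
  have fin: "finite D_S"
    using sub finite_subset by blast
  have set_p: "set p = insert 0 (insert (n + 1) D_S)"
    using fin by (auto simp: p_def)
  \<comment> \<open>Strict order gives both distinctness of the vertices and the absence of elements
    of \<open>D_S\<close> between neighbouring entries.\<close>
  have sorted_p: "sorted_wrt (<) p"
    using sub fin by (fastforce simp: p_def sorted_wrt_append)
  have less_p: "p ! l < p ! m" if "l < m" "m < length p" for l m
    using sorted_wrt_nth_less[OF sorted_p that] .
  have gap: "u \<le> p ! m \<or> p ! Suc m \<le> u" if "u \<in> D_S" "Suc m < length p" for u m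
    using sorted_wrt_less_nth_gap[OF sorted_p that(2)] set_p that(1) by simp
  have mem_init: "p ! m \<in> insert 0 D_S" if "Suc m < length p" for m
  proof -
    \<comment> \<open>An entry with a successor is smaller than some entry, hence is not
      \<open>n + 1\<close>.\<close>
    have "p ! m < p ! Suc m" "p ! Suc m \<le> n + 1"
      using less_p that nth_mem[OF that] set_p sub by auto
    then show ?thesis
      using nth_mem[of m p] that set_p by auto
  qed
  have mem_tail: "p ! Suc m \<in> insert (n + 1) D_S" if "Suc m < length p" for m
    using less_p[of m "Suc m"] nth_mem[OF that] that set_p by auto
  have arcs: "(p ! m, p ! Suc m) \<in> A1_set a b n \<union> A2_set a b n" if "Suc m < length p" for m
    using gap_arc[OF sub sub_V dom mem_init mem_tail] gap less_p[of m "Suc m"] that by blast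
  have "set (vwalk_arcs p) \<subseteq> A1_set a b n \<union> A2_set a b n"
  proof
    fix e assume "e \<in> set (vwalk_arcs p)"
    then obtain m where "Suc m < length p" "e = vwalk_arcs p ! m"
      by (auto simp: in_set_conv_nth length_vwalk_arcs less_diff_conv)
    then show "e \<in> A1_set a b n \<union> A2_set a b n"
      using arcs by (simp add: nth_vwalk_arcs)
  qed
  moreover have "set p \<subseteq> V_set a b n"
    using set_p sub_V zero_mem_V_set Suc_n_mem_V_set by simp
  moreover have "distinct p"
    using sorted_p by (simp add: strict_sorted_iff)
  moreover have "p \<noteq> []" "hd p = 0" "List.last p = n + 1"
    by (simp_all add: p_def)
  ultimately have "dipath (with_proj (D_graph a b n)) 0 p (n + 1)"
    unfolding dipath_def vpath_def vwalk_def by (simp add: D_graph_def)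
  moreover have "no_consecutive (unmarked a b n) (vwalk_arcs p)"
    unfolding no_consecutive_def
  proof (intro allI impI)
    fix m assume "Suc m < length (vwalk_arcs p)"
    then have m: "Suc (Suc m) < length p"
      by (simp add: length_vwalk_arcs)
    \<comment> \<open>The common vertex of two consecutive arcs has a successor and a predecessor in
      \<open>p\<close>, so it is neither end of the path.\<close>
    then have "p ! Suc m \<in> D_S"
      using mem_init[of "Suc m"] less_p[of m "Suc m"] by auto
    then have "\<not> (unmarked a b n (p ! m, p ! Suc m) \<and> unmarked a b n (p ! Suc m, p ! Suc (Suc m)))"
      using no_two_unmarked[OF sub sub_V dom dist] gap m by (meson Suc_lessD)
    then show "\<not> (unmarked a b n (vwalk_arcs p ! m) \<and> unmarked a b n (vwalk_arcs p ! Suc m))"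
      using m by (simp add: nth_vwalk_arcs)
  qed
  ultimately show ?thesis ..
qed

end
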